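(* Let $(A,\mathfrak{m})$ be a Noetherian local ring with infinite residue field and let $M$ be a finitely generated Cohen-Macaulay $A$-module of dimension $r \geq 2$. Let $I$ be an ideal of definition for $M$. Suppose $x,y\in I$ are two distinct elements which are $M$-superficial with respect to $I$. The following conditions are equivalent: (i) The Ratliff-Rush filtration on $M$ with respect to $I$ behaves well mod $x$. (ii) The Ratliff-Rush filtration on $M$ with respect to $I$ behaves well mod $y$.
   Context: An ideal $I\subseteq\mathfrak m$ is an ideal of definition for $M$ if $M/IM$ has finite length. An element $x\in I$ is $M$-superficial with respect to $I$ if $(I^{n+1}M:_M x)=I^nM$ for all $n\gg 0$. The Ratliff-Rush filtration of a module $E$ with respect to $I$ is $\widetilde{I^nE}=\bigcup_{k\ge 1}(I^{n+k}E:_E I^k)$. For an $M$-superficial element $x$, with $N=M/xM$ and $\rho: M\to N$ the natural map, one always has $\rho(\widetilde{I^nM})\subseteq \widetilde{I^nN}$; the Ratliff-Rush filtration on $M$ with respect to $I$ "behaves well mod $x$" if $\rho(\widetilde{I^nM})=\widetilde{I^nN}$ for all $n\ge 1$. *)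

theory Defs
  imports "HOL-Algebra.Module" "HOL-Algebra.QuotRing" "HOL-Algebra.Ideal_Product"
    "HOL-Algebra.Ring_Divisibility" "HOL-Library.Extended_Nat"
begin

section \<open>Local rings and Krull dimension\<close>

locale noetherian_local_ring = cring R + noetherian_ring R for \<mm> and R (structure) +
  assumes maximal: "maximalideal \<mm> R"
    and unique_maximal: "maximalideal J R \<Longrightarrow> J = \<mm>"

text \<open>Since \<open>Sup {} = 0\<close> in \<^typ>\<open>enat\<close>, the zero ring gets dimension \<open>0\<close> (not \<open>-\<infinity>\<close>),
  and likewise the zero module gets dimension and depth \<open>0\<close> below.\<close>

definition krull_dim :: "('a, 'r) ring_scheme \<Rightarrow> enat"
  where "krull_dim R =
    Sup {enat n | n. \<exists>P :: nat \<Rightarrow> 'a set.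
           (\<forall>i\<le>n. primeideal (P i) R) \<and> (\<forall>i<n. P i \<subset> P (Suc i))}"

text \<open>\<open>I\<^sup>n\<close>, as a power in the monoid of ideals under the ideal product; \<open>I\<^sup>0\<close> is the whole ring.\<close>

abbreviation ideal_pow :: "('a, 'r) ring_scheme \<Rightarrow> 'a set \<Rightarrow> nat \<Rightarrow> 'a set"
  where "ideal_pow R I n \<equiv> I [^]\<^bsub>ideals_set R\<^esub> n"


section \<open>Submodules, quotients, length\<close>

definition module_span :: "('a, 'r) ring_scheme \<Rightarrow> ('a, 'b, 'm) module_scheme \<Rightarrow> 'b set \<Rightarrow> 'b set"
  where "module_span R M S = \<Inter>{N. submodule N R M \<and> S \<subseteq> N}"

definition finitely_generated_module :: "('a, 'r) ring_scheme \<Rightarrow> ('a, 'b, 'm) module_scheme \<Rightarrow> bool"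
  where "finitely_generated_module R M \<longleftrightarrow>
    (\<exists>S\<subseteq>carrier M. finite S \<and> module_span R M S = carrier M)"

definition ideal_smult :: "('a, 'r) ring_scheme \<Rightarrow> 'a set \<Rightarrow> ('a, 'b, 'm) module_scheme \<Rightarrow> 'b set"
  where "ideal_smult R I M = module_span R M {a \<odot>\<^bsub>M\<^esub> m | a m. a \<in> I \<and> m \<in> carrier M}"

definition elt_smult :: "'a \<Rightarrow> ('a, 'b, 'm) module_scheme \<Rightarrow> 'b set"
  where "elt_smult x M = {x \<odot>\<^bsub>M\<^esub> m | m. m \<in> carrier M}"

definition colon :: "('a, 'b, 'm) module_scheme \<Rightarrow> 'b set \<Rightarrow> 'a set \<Rightarrow> 'b set"
  where "colon M N J = {m \<in> carrier M. \<forall>a\<in>J. a \<odot>\<^bsub>M\<^esub> m \<in> N}"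

definition annihilator :: "('a, 'r) ring_scheme \<Rightarrow> ('a, 'b, 'm) module_scheme \<Rightarrow> 'a set"
  where "annihilator R M = {a \<in> carrier R. \<forall>m\<in>carrier M. a \<odot>\<^bsub>M\<^esub> m = \<zero>\<^bsub>M\<^esub>}"

text \<open>Module records extend ring records, so they have fields for
  a multiplication and a unit; these play no role for modules and are left unspecified.\<close>

definition quotient_module :: "('a, 'b, 'm) module_scheme \<Rightarrow> 'b set \<Rightarrow> ('a, 'b set) module"
  where "quotient_module M N =
    \<lparr>carrier = a_rcosets\<^bsub>M\<^esub> N, monoid.mult = undefined, one = undefined,
     zero = N, add = set_add M, smult = (\<lambda>a X. \<Union>m\<in>X. N +>\<^bsub>M\<^esub> (a \<odot>\<^bsub>M\<^esub> m))\<rparr>"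

lemma (in module) quotient_module_smult:
  assumes N: "submodule N R M" and a: "a \<in> carrier R" and m: "m \<in> carrier M"
  shows "a \<odot>\<^bsub>quotient_module M N\<^esub> (N +>\<^bsub>M\<^esub> m) = N +>\<^bsub>M\<^esub> (a \<odot>\<^bsub>M\<^esub> m)"
proof -
  interpret N: submodule N R M by (rule N)
  have sg: "subgroup N (add_monoid M)" by (rule N.subgroup_axioms)
  have sub: "N \<subseteq> carrier M" using submoduleE(1)[OF N] .
  have "N +>\<^bsub>M\<^esub> (a \<odot>\<^bsub>M\<^esub> m') = N +>\<^bsub>M\<^esub> (a \<odot>\<^bsub>M\<^esub> m)" if m': "m' \<in> N +>\<^bsub>M\<^esub> m" for m'
  proof -
    obtain h where h: "h \<in> N" "m' = h \<oplus>\<^bsub>M\<^esub> m"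
      using m' by (auto simp: a_r_coset_def r_coset_def)
    have hc: "h \<in> carrier M" using h sub by auto
    have ah: "a \<odot>\<^bsub>M\<^esub> h \<in> N" using N.smult_closed a h by auto
    have "a \<odot>\<^bsub>M\<^esub> m' = a \<odot>\<^bsub>M\<^esub> h \<oplus>\<^bsub>M\<^esub> a \<odot>\<^bsub>M\<^esub> m"
      using smult_r_distr a hc m h by auto
    then have "a \<odot>\<^bsub>M\<^esub> m' \<in> N +>\<^bsub>M\<^esub> (a \<odot>\<^bsub>M\<^esub> m)"
      using ah by (auto simp: a_r_coset_def r_coset_def)
    then show ?thesis
      using M.add.repr_independence[OF _ _ sg] a m by (simp add: a_r_coset_def)
  qed
  then have "(\<Union>m'\<in>N +>\<^bsub>M\<^esub> m. N +>\<^bsub>M\<^esub> (a \<odot>\<^bsub>M\<^esub> m')) = (\<Union>m'\<in>N +>\<^bsub>M\<^esub> m. N +>\<^bsub>M\<^esub> (a \<odot>\<^bsub>M\<^esub> m))"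
    by (rule SUP_cong[OF refl])
  also have "\<dots> = N +>\<^bsub>M\<^esub> (a \<odot>\<^bsub>M\<^esub> m)"
    using M.add.rcos_self[OF m sg] by (auto simp: a_r_coset_def)
  finally show ?thesis
    by (simp add: quotient_module_def)
qed

lemma (in module) quotient_module_is_module:
  assumes N: "submodule N R M"
  shows "module R (quotient_module M N)"
proof -
  let ?Q = "quotient_module M N"
  have as: "additive_subgroup N M"
    using N unfolding submodule_def additive_subgroup_def by simp
  interpret N: abelian_subgroup N M
    by (rule abelian_subgroupI3[OF as M.abelian_group_axioms])
  have add: "(N +>\<^bsub>M\<^esub> u) \<oplus>\<^bsub>?Q\<^esub> (N +>\<^bsub>M\<^esub> v) = N +>\<^bsub>M\<^esub> (u \<oplus>\<^bsub>M\<^esub> v)"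
    if "u \<in> carrier M" "v \<in> carrier M" for u v
    using N.a_rcos_sum[OF that] by (simp add: quotient_module_def)
  have carr: "X \<in> carrier ?Q \<longleftrightarrow> (\<exists>u\<in>carrier M. X = N +>\<^bsub>M\<^esub> u)" for X
    by (auto simp: quotient_module_def A_RCOSETS_def')
  have carrE: thesis if "C \<in> carrier ?Q" "\<And>u. u \<in> carrier M \<Longrightarrow> C = N +>\<^bsub>M\<^esub> u \<Longrightarrow> thesis" for C thesis
    using that by (auto simp: carr)
  have carrI: "N +>\<^bsub>M\<^esub> u \<in> carrier ?Q" if "u \<in> carrier M" for u
    using that by (auto simp: carr)
  have zero: "\<zero>\<^bsub>?Q\<^esub> = N +>\<^bsub>M\<^esub> \<zero>\<^bsub>M\<^esub>"
    by (simp add: quotient_module_def N.a_subset)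
  note smult = quotient_module_smult[OF N]
  have inv: "\<exists>Y\<in>carrier ?Q. Y \<oplus>\<^bsub>?Q\<^esub> X = \<zero>\<^bsub>?Q\<^esub>" if X: "X \<in> carrier ?Q" for X
  proof -
    obtain u where "u \<in> carrier M" "X = N +>\<^bsub>M\<^esub> u" using X by (rule carrE)
    then show ?thesis
      by (intro bexI[of _ "N +>\<^bsub>M\<^esub> (\<ominus>\<^bsub>M\<^esub> u)"]) (simp_all add: add carrI zero M.l_neg)
  qed
  have "abelian_group ?Q"
  proof (rule abelian_groupI)
    show "\<zero>\<^bsub>?Q\<^esub> \<in> carrier ?Q"
      by (simp add: zero carrI)
    show "C \<oplus>\<^bsub>?Q\<^esub> D \<in> carrier ?Q" if "C \<in> carrier ?Q" "D \<in> carrier ?Q" for C D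
      using that(1)
    proof (rule carrE)
      fix u assume u: "u \<in> carrier M" "C = N +>\<^bsub>M\<^esub> u"
      show ?thesis using that(2) by (rule carrE) (simp add: u add carrI)
    qed
    show "C \<oplus>\<^bsub>?Q\<^esub> D = D \<oplus>\<^bsub>?Q\<^esub> C" if "C \<in> carrier ?Q" "D \<in> carrier ?Q" for C D
      using that(1)
    proof (rule carrE)
      fix u assume u: "u \<in> carrier M" "C = N +>\<^bsub>M\<^esub> u"
      show ?thesis using that(2) by (rule carrE) (simp add: u add M.a_comm)
    qed
    show "(C \<oplus>\<^bsub>?Q\<^esub> D) \<oplus>\<^bsub>?Q\<^esub> E = C \<oplus>\<^bsub>?Q\<^esub> (D \<oplus>\<^bsub>?Q\<^esub> E)"
      if "C \<in> carrier ?Q" "D \<in> carrier ?Q" "E \<in> carrier ?Q" for C D E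
      using that(1)
    proof (rule carrE)
      fix u assume u: "u \<in> carrier M" "C = N +>\<^bsub>M\<^esub> u"
      show ?thesis using that(2)
      proof (rule carrE)
        fix v assume v: "v \<in> carrier M" "D = N +>\<^bsub>M\<^esub> v"
        show ?thesis using that(3) by (rule carrE) (simp add: u v add M.a_assoc)
      qed
    qed
    show "\<zero>\<^bsub>?Q\<^esub> \<oplus>\<^bsub>?Q\<^esub> C = C" if "C \<in> carrier ?Q" for C
      using that by (rule carrE) (simp add: add zero)
    show "\<exists>Y\<in>carrier ?Q. Y \<oplus>\<^bsub>?Q\<^esub> C = \<zero>\<^bsub>?Q\<^esub>" if "C \<in> carrier ?Q" for C
      using that by (rule inv)
  qed
  then show ?thesis
    by (intro moduleI is_cring)
       (auto elim!: carrE simp: carrI add smult smult_l_distr smult_r_distr smult_assoc1)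
qed

definition module_length :: "('a, 'r) ring_scheme \<Rightarrow> ('a, 'b, 'm) module_scheme \<Rightarrow> enat"
  where "module_length R M =
    Sup {enat n | n. \<exists>F :: nat \<Rightarrow> 'b set.
           (\<forall>i\<le>n. submodule (F i) R M) \<and> (\<forall>i<n. F i \<subset> F (Suc i))}"

definition finite_length :: "('a, 'r) ring_scheme \<Rightarrow> ('a, 'b, 'm) module_scheme \<Rightarrow> bool"
  where "finite_length R M \<longleftrightarrow> module_length R M \<noteq> \<infinity>"


section \<open>Dimension, depth and Cohen--Macaulay modules\<close>

definition module_dim :: "('a, 'r) ring_scheme \<Rightarrow> ('a, 'b, 'm) module_scheme \<Rightarrow> enat"
  where "module_dim R M = krull_dim (R Quot annihilator R M)"

definition module_nonzerodivisor :: "('a, 'b, 'm) module_scheme \<Rightarrow> 'a \<Rightarrow> bool"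
  where "module_nonzerodivisor M x \<longleftrightarrow>
    (\<forall>m\<in>carrier M. x \<odot>\<^bsub>M\<^esub> m = \<zero>\<^bsub>M\<^esub> \<longrightarrow> m = \<zero>\<^bsub>M\<^esub>)"

definition regular_sequence :: "('a, 'r) ring_scheme \<Rightarrow> ('a, 'b, 'm) module_scheme \<Rightarrow> 'a list \<Rightarrow> bool"
  where "regular_sequence R M xs \<longleftrightarrow>
    set xs \<subseteq> carrier R \<and>
    (\<forall>i<length xs.
       module_nonzerodivisor
         (quotient_module M (ideal_smult R (Idl\<^bsub>R\<^esub> (set (take i xs))) M)) (xs ! i)) \<and>
    ideal_smult R (Idl\<^bsub>R\<^esub> (set xs)) M \<noteq> carrier M"

definition depth :: "('a, 'r) ring_scheme \<Rightarrow> 'a set \<Rightarrow> ('a, 'b, 'm) module_scheme \<Rightarrow> enat"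
  where "depth R \<mm> M = Sup {enat (length xs) | xs. set xs \<subseteq> \<mm> \<and> regular_sequence R M xs}"

definition cohen_macaulay_module ::
    "('a, 'r) ring_scheme \<Rightarrow> 'a set \<Rightarrow> ('a, 'b, 'm) module_scheme \<Rightarrow> bool"
  where "cohen_macaulay_module R \<mm> M \<longleftrightarrow>
    finitely_generated_module R M \<and> depth R \<mm> M = module_dim R M"


section \<open>Superficial elements and the Ratliff--Rush filtration\<close>

definition ideal_of_definition ::
    "('a, 'r) ring_scheme \<Rightarrow> 'a set \<Rightarrow> ('a, 'b, 'm) module_scheme \<Rightarrow> 'a set \<Rightarrow> bool"
  where "ideal_of_definition R \<mm> M I \<longleftrightarrow>
    ideal I R \<and> I \<subseteq> \<mm> \<and> finite_length R (quotient_module M (ideal_smult R I M))"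

definition superficial ::
    "('a, 'r) ring_scheme \<Rightarrow> ('a, 'b, 'm) module_scheme \<Rightarrow> 'a set \<Rightarrow> 'a \<Rightarrow> bool"
  where "superficial R M I x \<longleftrightarrow>
    x \<in> I \<and>
    (\<forall>\<^sub>F n in sequentially.
       colon M (ideal_smult R (ideal_pow R I (n + 1)) M) {x} = ideal_smult R (ideal_pow R I n) M)"

definition ratliff_rush ::
    "('a, 'r) ring_scheme \<Rightarrow> ('a, 'b, 'm) module_scheme \<Rightarrow> 'a set \<Rightarrow> nat \<Rightarrow> 'b set"
  where "ratliff_rush R E I n =
    (\<Union>k\<in>{1..}. colon E (ideal_smult R (ideal_pow R I (n + k)) E) (ideal_pow R I k))"

text \<open>The natural map \<open>\<rho>: M \<rightarrow> M/xM\<close> sends \<open>m\<close> to its coset \<open>xM + m\<close>.\<close>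

definition rr_behaves_well_mod ::
    "('a, 'r) ring_scheme \<Rightarrow> ('a, 'b, 'm) module_scheme \<Rightarrow> 'a set \<Rightarrow> 'a \<Rightarrow> bool"
  where "rr_behaves_well_mod R M I x \<longleftrightarrow>
    (\<forall>n\<ge>1. (\<lambda>m. elt_smult x M +>\<^bsub>M\<^esub> m) ` ratliff_rush R M I n =
            ratliff_rush R (quotient_module M (elt_smult x M)) I n)"

end

theory Submission
  imports Defs
begin

text \<open>
  Write \<open>F\<^sub>n = I\<^sup>nM\<close>. Suppose that the coset of \<open>m\<close> lies in the \<open>n\<close>-th Ratliff--Rush submodule
  of \<open>M/yM\<close>. Then for every large \<open>j\<close> and every \<open>a \<in> I\<^sup>j\<close> there is some \<open>g(a) \<in> M\<close> such that
  \<open>a m - y g(a) \<in> F\<^sub>n\<^sub>+\<^sub>j\<close>, and since \<open>y\<close> is superficial, \<open>g(a)\<close> is determined modulo \<open>F\<^sub>n\<^sub>+\<^sub>j\<^sub>-\<^sub>1\<close>.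
  The element \<open>m - y u\<close> lies in the \<open>n\<close>-th Ratliff--Rush submodule of \<open>M\<close> exactly when
  \<open>g(a) \<equiv> a u\<close> for all \<open>a\<close> in high powers of \<open>I\<close>. So lifting the coset of \<open>m\<close> means to represent
  the family \<open>g\<close> as multiplication by one element \<open>u\<close>. The obstruction is a class in the first
  local cohomology of \<open>\<Oplus>\<^sub>n M/F\<^sub>n\<close>, as a module over the Rees algebra of \<open>I\<close>, with support in the
  ideal of elements of positive degree.

  Such a class is killed by a power of \<open>x\<close>: the family \<open>a \<mapsto> x\<^sup>k g(a) \<equiv> a g(x\<^sup>k)\<close> is
  multiplication by \<open>g(x\<^sup>k)\<close> (lemma \<open>quotient_represented_pow\<close>). If the filtration
  behaves well mod \<open>x\<close> and \<open>x\<close> is superficial, then \<open>x\<close> can be cancelled: when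
  \<open>x\<^sup>i\<^sup>+\<^sup>1 g\<close> is multiplication by \<open>u\<close>, the element \<open>u\<close> is a Ratliff--Rush element mod \<open>x\<close>, so
  it is congruent to some \<open>x v\<close> modulo a Ratliff--Rush element of \<open>M\<close>, and \<open>x\<^sup>i g\<close> is
  multiplication by \<open>v\<close> (lemma \<open>quotient_represented_descend\<close>). Cancelling all factors \<open>x\<close> shows
  that \<open>g\<close> itself is multiplication by an element, hence that the filtration behaves well
  mod \<open>y\<close>. The equivalence follows by exchanging \<open>x\<close> and \<open>y\<close>.
\<close>

section \<open>Submodules generated by an ideal\<close>

context module
begin

lemma smult_commute:
  assumes "a \<in> carrier R" "b \<in> carrier R" "m \<in> carrier M"
  shows "a \<odot>\<^bsub>M\<^esub> (b \<odot>\<^bsub>M\<^esub> m) = b \<odot>\<^bsub>M\<^esub> (a \<odot>\<^bsub>M\<^esub> m)"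
  using assms by (metis smult_assoc1 R.m_comm)

lemma smult_minus_distrib:
  assumes "a \<in> carrier R" "m \<in> carrier M" "m' \<in> carrier M"
  shows "a \<odot>\<^bsub>M\<^esub> (m \<ominus>\<^bsub>M\<^esub> m') = a \<odot>\<^bsub>M\<^esub> m \<ominus>\<^bsub>M\<^esub> a \<odot>\<^bsub>M\<^esub> m'"
  using assms by (simp add: M.minus_eq smult_r_distr smult_r_minus)

lemma submodule_minus_closed:
  assumes "submodule N R M" "u \<in> N" "v \<in> N"
  shows "u \<ominus>\<^bsub>M\<^esub> v \<in> N"
  using submoduleE[OF assms(1)] assms(2,3) by (simp add: M.minus_eq)

lemma minus_minus_cancel_left:
  assumes "p \<in> carrier M" "q \<in> carrier M" "s \<in> carrier M"
  shows "(p \<ominus>\<^bsub>M\<^esub> q) \<ominus>\<^bsub>M\<^esub> (p \<ominus>\<^bsub>M\<^esub> s) = s \<ominus>\<^bsub>M\<^esub> q"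
proof -
  have "(p \<ominus>\<^bsub>M\<^esub> q) \<ominus>\<^bsub>M\<^esub> (p \<ominus>\<^bsub>M\<^esub> s) = (s \<ominus>\<^bsub>M\<^esub> q) \<oplus>\<^bsub>M\<^esub> (p \<oplus>\<^bsub>M\<^esub> \<ominus>\<^bsub>M\<^esub> p)"
    using assms by (simp add: M.minus_eq M.minus_add M.a_ac del: M.r_neg)
  then show ?thesis using assms by (simp add: M.r_neg)
qed

lemma minus_add_minus_cancel:
  assumes "p \<in> carrier M" "q \<in> carrier M" "s \<in> carrier M"
  shows "(p \<ominus>\<^bsub>M\<^esub> q) \<oplus>\<^bsub>M\<^esub> (q \<ominus>\<^bsub>M\<^esub> s) = p \<ominus>\<^bsub>M\<^esub> s"
  using assms by (simp add: M.minus_eq M.a_assoc M.r_neg1)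

lemma minus_minus_self:
  assumes "p \<in> carrier M" "q \<in> carrier M"
  shows "p \<ominus>\<^bsub>M\<^esub> (p \<ominus>\<^bsub>M\<^esub> q) = q"
  using assms by (simp add: M.minus_eq M.minus_add M.r_neg2)

lemma module_span_submodule:
  assumes "S \<subseteq> carrier M"
  shows "submodule (module_span R M S) R M"
proof (rule submoduleI)
  show "module_span R M S \<subseteq> carrier M"
    using assms carrier_is_submodule by (auto simp: module_span_def)
qed (auto simp: module_span_def dest: submoduleE intro: subgroup.one_closed[of _ "add_monoid M", simplified] submodule.axioms(1))

lemma ideal_smult_submodule:
  assumes "J \<subseteq> carrier R"
  shows "submodule (ideal_smult R J M) R M"
  unfolding ideal_smult_def using assms by (intro module_span_submodule) auto

lemma ideal_smult_least:
  assumes "submodule N R M" "\<And>a m. a \<in> J \<Longrightarrow> m \<in> carrier M \<Longrightarrow> a \<odot>\<^bsub>M\<^esub> m \<in> N"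
  shows "ideal_smult R J M \<subseteq> N"
  unfolding ideal_smult_def module_span_def using assms by blast

lemma smult_in_ideal_smult:
  assumes "a \<in> J" "m \<in> carrier M"
  shows "a \<odot>\<^bsub>M\<^esub> m \<in> ideal_smult R J M"
  unfolding ideal_smult_def module_span_def using assms by blast

lemma elt_smult_submodule:
  assumes "x \<in> carrier R"
  shows "submodule (elt_smult x M) R M"
proof (rule submoduleI)
  show "\<zero>\<^bsub>M\<^esub> \<in> elt_smult x M"
    using assms unfolding elt_smult_def
    by (metis (mono_tags, lifting) M.zero_closed mem_Collect_eq smult_r_null)
  show "\<ominus>\<^bsub>M\<^esub> u \<in> elt_smult x M" if "u \<in> elt_smult x M" for u
    using that assms unfolding elt_smult_def
    by (smt (verit) M.a_inv_closed mem_Collect_eq smult_r_minus)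
  show "u \<oplus>\<^bsub>M\<^esub> v \<in> elt_smult x M" if "u \<in> elt_smult x M" "v \<in> elt_smult x M" for u v
    using that assms unfolding elt_smult_def
    by (smt (verit) M.add.m_closed mem_Collect_eq smult_r_distr)
  show "a \<odot>\<^bsub>M\<^esub> u \<in> elt_smult x M" if "a \<in> carrier R" "u \<in> elt_smult x M" for a u
    using that assms unfolding elt_smult_def
    by (smt (verit) smult_closed mem_Collect_eq smult_commute)
qed (use assms in \<open>auto simp: elt_smult_def\<close>)


section \<open>The adic filtration\<close>

lemma ideal_pow_ideal:
  assumes "ideal I R"
  shows "ideal (ideal_pow R I n) R"
proof -
  interpret ideals: comm_monoid "ideals_set R" by (rule ideals_set_is_comm_monoid)
  show ?thesis using ideals.nat_pow_closed[of I n] assms by (simp add: ideals_set_def)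
qed

lemma ideal_pow_carrier:
  assumes "ideal I R" "a \<in> ideal_pow R I n"
  shows "a \<in> carrier R"
  using ideal.Icarr[OF ideal_pow_ideal[OF assms(1)] assms(2)] .

lemma ideal_pow_add:
  assumes "ideal I R"
  shows "ideal_pow R I (i + j) = ideal_prod R (ideal_pow R I i) (ideal_pow R I j)"
proof -
  interpret ideals: comm_monoid "ideals_set R" by (rule ideals_set_is_comm_monoid)
  show ?thesis using ideals.nat_pow_mult[of I i j] assms by (simp add: ideals_set_def)
qed

lemma pow_in_ideal_pow:
  assumes "ideal I R" "x \<in> I"
  shows "x [^]\<^bsub>R\<^esub> n \<in> ideal_pow R I n"
proof (induction n)
  case 0
  then show ?case by (simp add: ideals_set_def)
next
  case (Suc n)
  then show ?case using assms by (simp add: ideals_set_def ideal_prod.prod)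
qed

lemma ideal_pow_one:
  assumes "ideal I R"
  shows "ideal_pow R I 1 = I"
proof -
  interpret ideals: comm_monoid "ideals_set R" by (rule ideals_set_is_comm_monoid)
  show ?thesis using ideals.nat_pow_eone[of I] assms by (simp add: ideals_set_def)
qed

definition adic :: "'a set \<Rightarrow> nat \<Rightarrow> 'c set"
  where "adic I n = ideal_smult R (ideal_pow R I n) M"

lemma adic_submodule:
  assumes "ideal I R"
  shows "submodule (adic I n) R M"
  unfolding adic_def using ideal_pow_carrier[OF assms] by (intro ideal_smult_submodule) auto

lemma colon_submodule:
  assumes N: "submodule N R M" and J: "J \<subseteq> carrier R"
  shows "submodule (colon M N J) R M"
proof (rule submoduleI)
  note N_closed = submoduleE[OF N]
  show "\<zero>\<^bsub>M\<^esub> \<in> colon M N J"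
    using J submodule.axioms(1)[OF N] subgroup.one_closed[of N "add_monoid M"]
    by (auto simp: colon_def)
  show "\<ominus>\<^bsub>M\<^esub> u \<in> colon M N J" if "u \<in> colon M N J" for u
    using that J N_closed by (auto simp: colon_def smult_r_minus)
  show "u \<oplus>\<^bsub>M\<^esub> v \<in> colon M N J" if "u \<in> colon M N J" "v \<in> colon M N J" for u v
    using that J N_closed by (auto simp: colon_def smult_r_distr subset_iff)
  show "a \<odot>\<^bsub>M\<^esub> u \<in> colon M N J" if "a \<in> carrier R" "u \<in> colon M N J" for a u
    using that J N_closed by (auto simp: colon_def smult_commute[of _ a] subset_iff)
qed (auto simp: colon_def)

lemma smult_adic:
  assumes "ideal I R" "a \<in> ideal_pow R I i" "u \<in> adic I j"
  shows "a \<odot>\<^bsub>M\<^esub> u \<in> adic I (i + j)"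
proof -
  have a: "a \<in> carrier R" using assms ideal_pow_carrier by blast
  have "ideal_smult R (ideal_pow R I j) M \<subseteq> colon M (adic I (i + j)) {a}"
  proof (rule ideal_smult_least)
    show "submodule (colon M (adic I (i + j)) {a}) R M"
      using assms a by (intro colon_submodule adic_submodule) auto
    fix b m assume b: "b \<in> ideal_pow R I j" and m: "m \<in> carrier M"
    have "(a \<otimes> b) \<odot>\<^bsub>M\<^esub> m \<in> adic I (i + j)"
      unfolding adic_def ideal_pow_add[OF assms(1)]
      using assms(2) b m by (intro smult_in_ideal_smult ideal_prod.prod)
    then show "b \<odot>\<^bsub>M\<^esub> m \<in> colon M (adic I (i + j)) {a}"
      using a ideal_pow_carrier[OF assms(1) b] m by (simp add: colon_def smult_assoc1)
  qed
  then show ?thesis using assms(3) by (auto simp: adic_def colon_def)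
qed

lemma smult_ideal_adic:
  assumes "ideal I R" "a \<in> I" "u \<in> adic I j"
  shows "a \<odot>\<^bsub>M\<^esub> u \<in> adic I (Suc j)"
  using smult_adic[OF assms(1), of a 1 u j] assms(2,3) unfolding ideal_pow_one[OF assms(1)] by simp

text \<open>
  The condition that defines the Ratliff--Rush filtration passes from one exponent to all larger
  ones, because \<open>I\<^sup>j = I\<^sup>j\<^sup>-\<^sup>k I\<^sup>k\<close>. It can therefore be tested for all large exponents at once, which
  lets several such conditions be combined.
\<close>

lemma ideal_pow_smult_stable:
  assumes I: "ideal I R" and m: "m \<in> carrier M"
    and k: "\<And>a. a \<in> ideal_pow R I k \<Longrightarrow> a \<odot>\<^bsub>M\<^esub> m \<in> adic I (n + k)"
    and "k \<le> j" and a: "a \<in> ideal_pow R I j"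
  shows "a \<odot>\<^bsub>M\<^esub> m \<in> adic I (n + j)"
proof -
  have "a \<in> ideal_prod R (ideal_pow R I (j - k)) (ideal_pow R I k)"
    using a \<open>k \<le> j\<close> by (simp flip: ideal_pow_add[OF I])
  then show ?thesis
  proof induction
    case (prod b c)
    have "b \<odot>\<^bsub>M\<^esub> (c \<odot>\<^bsub>M\<^esub> m) \<in> adic I (j - k + (n + k))"
      using smult_adic[OF I prod(1) k[OF prod(2)]] .
    moreover have "b \<in> carrier R" "c \<in> carrier R" using prod ideal_pow_carrier[OF I] by auto
    ultimately show ?case using m \<open>k \<le> j\<close> by (simp add: smult_assoc1 add.commute)
  next
    case (sum s t)
    have "s \<in> carrier R" "t \<in> carrier R"
      using sum.hyps ideal_prod_in_carrier[OF ideal_pow_ideal[OF I] ideal_pow_ideal[OF I]] by blast+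
    then show ?case
      using sum.IH m submoduleE(5)[OF adic_submodule[OF I]] by (simp add: smult_l_distr)
  qed
qed

lemma superficial_cancel:
  assumes "superficial R M I x"
  obtains n0 where "\<And>n u. n0 \<le> n \<Longrightarrow> u \<in> carrier M \<Longrightarrow> x \<odot>\<^bsub>M\<^esub> u \<in> adic I (Suc n) \<Longrightarrow> u \<in> adic I n"
proof -
  obtain n0 where n0: "\<And>n. n0 \<le> n \<Longrightarrow> colon M (adic I (Suc n)) {x} = adic I n"
    using assms unfolding superficial_def eventually_sequentially adic_def by auto
  show ?thesis
  proof (rule that)
    fix n u assume "n0 \<le> n" "u \<in> carrier M" "x \<odot>\<^bsub>M\<^esub> u \<in> adic I (Suc n)"
    then have "u \<in> colon M (adic I (Suc n)) {x}" by (simp add: colon_def)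
    then show "u \<in> adic I n" using n0 \<open>n0 \<le> n\<close> by simp
  qed
qed


section \<open>The Ratliff--Rush filtration modulo an element\<close>

lemma ratliff_rush_iff:
  "m \<in> ratliff_rush R M I n \<longleftrightarrow>
    m \<in> carrier M \<and> (\<exists>k\<ge>1. \<forall>a\<in>ideal_pow R I k. a \<odot>\<^bsub>M\<^esub> m \<in> adic I (n + k))"
  by (auto simp: ratliff_rush_def colon_def adic_def)

lemma coset_eq_iff:
  assumes P: "submodule P R M" and "u \<in> carrier M" "v \<in> carrier M"
  shows "P +>\<^bsub>M\<^esub> u = P +>\<^bsub>M\<^esub> v \<longleftrightarrow> u \<ominus>\<^bsub>M\<^esub> v \<in> P"
proof -
  have sg: "subgroup P (add_monoid M)" and sub: "P \<subseteq> carrier M"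
    using P submodule.axioms(1) submoduleE(1) by blast+
  have diff: "u \<oplus>\<^bsub>M\<^esub> \<ominus>\<^bsub>M\<^esub> v \<in> carrier M" using assms by simp
  show ?thesis
    unfolding M.minus_eq
  proof
    assume "P +>\<^bsub>M\<^esub> u = P +>\<^bsub>M\<^esub> v"
    from M.a_coset_add_inv2[OF this assms(2,3) sub] show "u \<oplus>\<^bsub>M\<^esub> \<ominus>\<^bsub>M\<^esub> v \<in> P"
      by (rule M.a_coset_join1[OF _ diff sg])
  next
    assume "u \<oplus>\<^bsub>M\<^esub> \<ominus>\<^bsub>M\<^esub> v \<in> P"
    from M.a_coset_join2[OF diff sg this] show "P +>\<^bsub>M\<^esub> u = P +>\<^bsub>M\<^esub> v"
      by (rule M.a_coset_add_inv1[OF _ assms(2,3) sub])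
  qed
qed

lemma carrier_quotient_module:
  "X \<in> carrier (quotient_module M P) \<longleftrightarrow> (\<exists>u\<in>carrier M. X = P +>\<^bsub>M\<^esub> u)"
  by (auto simp: quotient_module_def A_RCOSETS_def')

lemma quotient_module_add:
  assumes P: "submodule P R M" and "u \<in> carrier M" "v \<in> carrier M"
  shows "(P +>\<^bsub>M\<^esub> u) \<oplus>\<^bsub>quotient_module M P\<^esub> (P +>\<^bsub>M\<^esub> v) = P +>\<^bsub>M\<^esub> (u \<oplus>\<^bsub>M\<^esub> v)"
proof -
  have "additive_subgroup P M"
    using P unfolding submodule_def additive_subgroup_def by simp
  then interpret P: abelian_subgroup P M
    by (rule abelian_subgroupI3[OF _ M.abelian_group_axioms])
  show ?thesis using P.a_rcos_sum assms by (simp add: quotient_module_def)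
qed

text \<open>
  Images and preimages of submodules under \<open>M \<rightarrow> M/P\<close> are submodules. As \<open>JM\<close> and \<open>J(M/P)\<close> are
  smallest submodules containing certain products, this gives the two inclusions between
  \<open>J(M/P)\<close> and the image of \<open>JM\<close>.
\<close>

lemma image_submodule_quotient:
  assumes P: "submodule P R M" and U: "submodule U R M"
  shows "submodule ((\<lambda>u. P +>\<^bsub>M\<^esub> u) ` U) R (quotient_module M P)"
proof -
  interpret Q: module R "quotient_module M P" by (rule quotient_module_is_module[OF P])
  note U_closed = submoduleE[OF U]
  have UM: "u \<in> carrier M" if "u \<in> U" for u using that U_closed(1) by blast
  have zero: "\<zero>\<^bsub>M\<^esub> \<in> U"
    using submodule.axioms(1)[OF U] subgroup.one_closed[of U "add_monoid M"] by simp
  have smult: "a \<odot>\<^bsub>quotient_module M P\<^esub> X \<in> (\<lambda>u. P +>\<^bsub>M\<^esub> u) ` U"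
    if a: "a \<in> carrier R" and X: "X \<in> (\<lambda>u. P +>\<^bsub>M\<^esub> u) ` U" for a X
    using X a UM U_closed(4) by (auto simp: quotient_module_smult[OF P])
  show ?thesis
  proof (rule Q.submoduleI)
    show sub: "(\<lambda>u. P +>\<^bsub>M\<^esub> u) ` U \<subseteq> carrier (quotient_module M P)"
      using UM carrier_quotient_module by blast
    have "\<zero>\<^bsub>quotient_module M P\<^esub> = P +>\<^bsub>M\<^esub> \<zero>\<^bsub>M\<^esub>"
      using submoduleE(1)[OF P] by (simp add: quotient_module_def)
    then show "\<zero>\<^bsub>quotient_module M P\<^esub> \<in> (\<lambda>u. P +>\<^bsub>M\<^esub> u) ` U" using zero by auto
    show "\<ominus>\<^bsub>quotient_module M P\<^esub> X \<in> (\<lambda>u. P +>\<^bsub>M\<^esub> u) ` U" if "X \<in> (\<lambda>u. P +>\<^bsub>M\<^esub> u) ` U" for X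
    proof -
      have "X \<in> carrier (quotient_module M P)" using that sub by blast
      then have "\<ominus>\<^bsub>quotient_module M P\<^esub> X = (\<ominus> \<one>) \<odot>\<^bsub>quotient_module M P\<^esub> X"
        by (simp add: Q.smult_l_minus)
      then show ?thesis using smult[OF _ that, of "\<ominus> \<one>"] by simp
    qed
    show "X \<oplus>\<^bsub>quotient_module M P\<^esub> Y \<in> (\<lambda>u. P +>\<^bsub>M\<^esub> u) ` U"
      if "X \<in> (\<lambda>u. P +>\<^bsub>M\<^esub> u) ` U" "Y \<in> (\<lambda>u. P +>\<^bsub>M\<^esub> u) ` U" for X Y
      using that UM U_closed(5) by (auto simp: quotient_module_add[OF P])
  qed (rule smult)
qed

lemma preimage_submodule_quotient:
  assumes P: "submodule P R M" and V: "submodule V R (quotient_module M P)"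
  shows "submodule {u \<in> carrier M. P +>\<^bsub>M\<^esub> u \<in> V} R M"
proof -
  interpret Q: module R "quotient_module M P" by (rule quotient_module_is_module[OF P])
  note V_closed = Q.submoduleE[OF V]
  have smult: "a \<odot>\<^bsub>M\<^esub> u \<in> {u \<in> carrier M. P +>\<^bsub>M\<^esub> u \<in> V}"
    if "a \<in> carrier R" "u \<in> {u \<in> carrier M. P +>\<^bsub>M\<^esub> u \<in> V}" for a u
    using that V_closed(4) by (auto simp flip: quotient_module_smult[OF P])
  show ?thesis
  proof (rule submoduleI)
    have "\<zero>\<^bsub>quotient_module M P\<^esub> = P +>\<^bsub>M\<^esub> \<zero>\<^bsub>M\<^esub>"
      using submoduleE(1)[OF P] by (simp add: quotient_module_def)
    then show "\<zero>\<^bsub>M\<^esub> \<in> {u \<in> carrier M. P +>\<^bsub>M\<^esub> u \<in> V}"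
      using submodule.axioms(1)[OF V] subgroup.one_closed[of V "add_monoid (quotient_module M P)"]
      by simp
    show "\<ominus>\<^bsub>M\<^esub> u \<in> {u \<in> carrier M. P +>\<^bsub>M\<^esub> u \<in> V}" if "u \<in> {u \<in> carrier M. P +>\<^bsub>M\<^esub> u \<in> V}" for u
      using smult[of "\<ominus> \<one>", OF _ that] that smult_l_minus[of \<one> u] by auto
    show "u \<oplus>\<^bsub>M\<^esub> v \<in> {u \<in> carrier M. P +>\<^bsub>M\<^esub> u \<in> V}"
      if "u \<in> {u \<in> carrier M. P +>\<^bsub>M\<^esub> u \<in> V}" "v \<in> {u \<in> carrier M. P +>\<^bsub>M\<^esub> u \<in> V}" for u v
      using that V_closed(5) by (auto simp flip: quotient_module_add[OF P])
  qed (use smult in auto)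
qed

lemma ideal_smult_quotient_module:
  assumes P: "submodule P R M" and J: "J \<subseteq> carrier R"
  shows "ideal_smult R J (quotient_module M P) = (\<lambda>u. P +>\<^bsub>M\<^esub> u) ` ideal_smult R J M"
proof -
  interpret Q: module R "quotient_module M P" by (rule quotient_module_is_module[OF P])
  note smult = quotient_module_smult[OF P]
  show ?thesis
  proof
    show "ideal_smult R J (quotient_module M P) \<subseteq> (\<lambda>u. P +>\<^bsub>M\<^esub> u) ` ideal_smult R J M"
    proof (rule Q.ideal_smult_least[OF image_submodule_quotient[OF P ideal_smult_submodule[OF J]]])
      fix a X assume a: "a \<in> J" and "X \<in> carrier (quotient_module M P)"
      then obtain m where "m \<in> carrier M" "X = P +>\<^bsub>M\<^esub> m" by (auto simp: carrier_quotient_module)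
      moreover have "a \<in> carrier R" using a J by blast
      ultimately show "a \<odot>\<^bsub>quotient_module M P\<^esub> X \<in> (\<lambda>u. P +>\<^bsub>M\<^esub> u) ` ideal_smult R J M"
        using smult_in_ideal_smult[OF a] by (simp add: smult)
    qed
    have "ideal_smult R J M \<subseteq> {u \<in> carrier M. P +>\<^bsub>M\<^esub> u \<in> ideal_smult R J (quotient_module M P)}"
    proof (rule ideal_smult_least[OF preimage_submodule_quotient[OF P Q.ideal_smult_submodule[OF J]]])
      fix a m assume a: "a \<in> J" and m: "m \<in> carrier M"
      have "P +>\<^bsub>M\<^esub> m \<in> carrier (quotient_module M P)" using m by (auto simp: carrier_quotient_module)
      from Q.smult_in_ideal_smult[OF a this]
      show "a \<odot>\<^bsub>M\<^esub> m \<in> {u \<in> carrier M. P +>\<^bsub>M\<^esub> u \<in> ideal_smult R J (quotient_module M P)}"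
        using a J m by (auto simp: smult)
    qed
    then show "(\<lambda>u. P +>\<^bsub>M\<^esub> u) ` ideal_smult R J M \<subseteq> ideal_smult R J (quotient_module M P)"
      by blast
  qed
qed

lemma translate_meets_elt_smult_iff:
  assumes x: "x \<in> carrier R" and S: "S \<subseteq> carrier M" and u: "u \<in> carrier M"
  shows "(\<exists>v\<in>S. u \<ominus>\<^bsub>M\<^esub> v \<in> elt_smult x M) \<longleftrightarrow> (\<exists>w\<in>carrier M. u \<ominus>\<^bsub>M\<^esub> x \<odot>\<^bsub>M\<^esub> w \<in> S)"
proof
  assume "\<exists>v\<in>S. u \<ominus>\<^bsub>M\<^esub> v \<in> elt_smult x M"
  then obtain v w where v: "v \<in> S" and w: "w \<in> carrier M" "u \<ominus>\<^bsub>M\<^esub> v = x \<odot>\<^bsub>M\<^esub> w"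
    by (auto simp: elt_smult_def)
  have "u \<ominus>\<^bsub>M\<^esub> x \<odot>\<^bsub>M\<^esub> w = v"
    unfolding w(2)[symmetric] using u v S by (intro minus_minus_self) auto
  then show "\<exists>w\<in>carrier M. u \<ominus>\<^bsub>M\<^esub> x \<odot>\<^bsub>M\<^esub> w \<in> S" using v w(1) by blast
next
  assume "\<exists>w\<in>carrier M. u \<ominus>\<^bsub>M\<^esub> x \<odot>\<^bsub>M\<^esub> w \<in> S"
  then obtain w where w: "w \<in> carrier M" "u \<ominus>\<^bsub>M\<^esub> x \<odot>\<^bsub>M\<^esub> w \<in> S" by blast
  then show "\<exists>v\<in>S. u \<ominus>\<^bsub>M\<^esub> v \<in> elt_smult x M"
    using x u minus_minus_self[of u "x \<odot>\<^bsub>M\<^esub> w"]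
    by (intro bexI[OF _ w(2)]) (auto simp: elt_smult_def)
qed

lemma coset_in_ideal_smult_iff:
  assumes x: "x \<in> carrier R" and J: "J \<subseteq> carrier R" and u: "u \<in> carrier M"
  shows "elt_smult x M +>\<^bsub>M\<^esub> u \<in> ideal_smult R J (quotient_module M (elt_smult x M)) \<longleftrightarrow>
    (\<exists>w\<in>carrier M. u \<ominus>\<^bsub>M\<^esub> x \<odot>\<^bsub>M\<^esub> w \<in> ideal_smult R J M)"
proof -
  note P = elt_smult_submodule[OF x]
  have sub: "v \<in> carrier M" if "v \<in> ideal_smult R J M" for v
    using submoduleE(1)[OF ideal_smult_submodule[OF J]] that by blast
  have "elt_smult x M +>\<^bsub>M\<^esub> u \<in> ideal_smult R J (quotient_module M (elt_smult x M)) \<longleftrightarrow>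
      (\<exists>v\<in>ideal_smult R J M. u \<ominus>\<^bsub>M\<^esub> v \<in> elt_smult x M)"
    using coset_eq_iff[OF P u] sub by (auto simp: ideal_smult_quotient_module[OF P J] image_iff)
  also have "\<dots> \<longleftrightarrow> (\<exists>w\<in>carrier M. u \<ominus>\<^bsub>M\<^esub> x \<odot>\<^bsub>M\<^esub> w \<in> ideal_smult R J M)"
    using sub by (intro translate_meets_elt_smult_iff[OF x _ u]) blast
  finally show ?thesis .
qed

text \<open>
  Membership of the coset of \<open>m\<close> in the \<open>n\<close>-th Ratliff--Rush submodule of \<open>M/xM\<close>, expressed by
  elements of \<open>M\<close> so that no cosets occur in the main argument.
\<close>

definition rr_mod :: "'a set \<Rightarrow> 'a \<Rightarrow> nat \<Rightarrow> 'c \<Rightarrow> bool"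
  where "rr_mod I x n m \<longleftrightarrow>
    (\<exists>k\<ge>1. \<forall>a\<in>ideal_pow R I k. \<exists>w\<in>carrier M. a \<odot>\<^bsub>M\<^esub> m \<ominus>\<^bsub>M\<^esub> x \<odot>\<^bsub>M\<^esub> w \<in> adic I (n + k))"

lemma coset_smult_in_adic_iff:
  assumes I: "ideal I R" and x: "x \<in> carrier R" and m: "m \<in> carrier M" and a: "a \<in> carrier R"
  shows "a \<odot>\<^bsub>quotient_module M (elt_smult x M)\<^esub> (elt_smult x M +>\<^bsub>M\<^esub> m)
      \<in> module.adic R (quotient_module M (elt_smult x M)) I n \<longleftrightarrow>
    (\<exists>w\<in>carrier M. a \<odot>\<^bsub>M\<^esub> m \<ominus>\<^bsub>M\<^esub> x \<odot>\<^bsub>M\<^esub> w \<in> adic I n)"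
proof -
  note P = elt_smult_submodule[OF x]
  interpret Q: module R "quotient_module M (elt_smult x M)"
    by (rule quotient_module_is_module[OF P])
  have "ideal_pow R I n \<subseteq> carrier R" using ideal_pow_carrier[OF I] by blast
  then show ?thesis
    using m a
    by (simp add: quotient_module_smult[OF P] Q.adic_def adic_def coset_in_ideal_smult_iff[OF x])
qed

lemma coset_in_ratliff_rush_iff:
  assumes I: "ideal I R" and x: "x \<in> carrier R" and m: "m \<in> carrier M"
  shows "elt_smult x M +>\<^bsub>M\<^esub> m \<in> ratliff_rush R (quotient_module M (elt_smult x M)) I n
    \<longleftrightarrow> rr_mod I x n m"
proof -
  interpret Q: module R "quotient_module M (elt_smult x M)"
    by (rule quotient_module_is_module[OF elt_smult_submodule[OF x]])
  have "elt_smult x M +>\<^bsub>M\<^esub> m \<in> carrier (quotient_module M (elt_smult x M))"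
    using m by (auto simp: carrier_quotient_module)
  then show ?thesis
    using coset_smult_in_adic_iff[OF I x m] ideal_pow_carrier[OF I]
    by (simp add: Q.ratliff_rush_iff rr_mod_def)
qed

text \<open>
  Stability in the exponent is inherited from the module \<open>M/xM\<close>; choosing the elements \<open>w\<close>
  by hand for sums of products is thereby avoided.
\<close>

lemma rr_mod_eventually:
  assumes I: "ideal I R" and x: "x \<in> carrier R" and m: "m \<in> carrier M" and "rr_mod I x n m"
  obtains k where "\<And>j a. k \<le> j \<Longrightarrow> a \<in> ideal_pow R I j \<Longrightarrow>
    \<exists>w\<in>carrier M. a \<odot>\<^bsub>M\<^esub> m \<ominus>\<^bsub>M\<^esub> x \<odot>\<^bsub>M\<^esub> w \<in> adic I (n + j)"
proof -
  interpret Q: module R "quotient_module M (elt_smult x M)"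
    by (rule quotient_module_is_module[OF elt_smult_submodule[OF x]])
  have coset: "elt_smult x M +>\<^bsub>M\<^esub> m \<in> carrier (quotient_module M (elt_smult x M))"
    using m by (auto simp: carrier_quotient_module)
  obtain k where k: "\<And>a. a \<in> ideal_pow R I k \<Longrightarrow>
      \<exists>w\<in>carrier M. a \<odot>\<^bsub>M\<^esub> m \<ominus>\<^bsub>M\<^esub> x \<odot>\<^bsub>M\<^esub> w \<in> adic I (n + k)"
    using assms(4) unfolding rr_mod_def by blast
  show ?thesis
  proof (rule that)
    fix j a assume "k \<le> j" and a: "a \<in> ideal_pow R I j"
    then show "\<exists>w\<in>carrier M. a \<odot>\<^bsub>M\<^esub> m \<ominus>\<^bsub>M\<^esub> x \<odot>\<^bsub>M\<^esub> w \<in> adic I (n + j)"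
      using Q.ideal_pow_smult_stable[OF I coset, of k n j a] k ideal_pow_carrier[OF I]
        coset_smult_in_adic_iff[OF I x m] by blast
  qed
qed

lemma ratliff_rush_eventually:
  assumes I: "ideal I R" and "m \<in> ratliff_rush R M I n"
  obtains k where "\<And>j a. k \<le> j \<Longrightarrow> a \<in> ideal_pow R I j \<Longrightarrow> a \<odot>\<^bsub>M\<^esub> m \<in> adic I (n + j)"
proof -
  obtain k where m: "m \<in> carrier M" and k: "\<And>a. a \<in> ideal_pow R I k \<Longrightarrow> a \<odot>\<^bsub>M\<^esub> m \<in> adic I (n + k)"
    using assms(2) unfolding ratliff_rush_iff by blast
  show ?thesis by (rule that[of k]) (rule ideal_pow_smult_stable[OF I m k])
qed

lemma ratliff_rush_imp_rr_mod:
  assumes I: "ideal I R" and x: "x \<in> carrier R" and m: "m \<in> ratliff_rush R M I n"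
  shows "rr_mod I x n m"
proof -
  have "a \<odot>\<^bsub>M\<^esub> m \<ominus>\<^bsub>M\<^esub> x \<odot>\<^bsub>M\<^esub> \<zero>\<^bsub>M\<^esub> = a \<odot>\<^bsub>M\<^esub> m" if "a \<in> ideal_pow R I k" for a k
    using m x ideal_pow_carrier[OF I that] by (auto simp: ratliff_rush_iff M.minus_eq)
  then show ?thesis
    using m unfolding ratliff_rush_iff rr_mod_def by (metis M.zero_closed)
qed

text \<open>
  The image of the Ratliff--Rush filtration always lies in that of the quotient, so good
  behaviour is only a lifting property.
\<close>

lemma rr_behaves_well_mod_iff:
  assumes I: "ideal I R" and x: "x \<in> carrier R"
  shows "rr_behaves_well_mod R M I x \<longleftrightarrow>
    (\<forall>n\<ge>1. \<forall>m\<in>carrier M. rr_mod I x n m \<longrightarrow>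
      (\<exists>w\<in>carrier M. m \<ominus>\<^bsub>M\<^esub> x \<odot>\<^bsub>M\<^esub> w \<in> ratliff_rush R M I n))"
proof -
  note P = elt_smult_submodule[OF x]
  let ?Q = "quotient_module M (elt_smult x M)"
  interpret Q: module R ?Q by (rule quotient_module_is_module[OF P])
  have coset: "elt_smult x M +>\<^bsub>M\<^esub> m \<in> (\<lambda>m. elt_smult x M +>\<^bsub>M\<^esub> m) ` ratliff_rush R M I n \<longleftrightarrow>
      (\<exists>w\<in>carrier M. m \<ominus>\<^bsub>M\<^esub> x \<odot>\<^bsub>M\<^esub> w \<in> ratliff_rush R M I n)" (is "?L \<longleftrightarrow> ?R")
    if m: "m \<in> carrier M" for n m
  proof -
    have "?L \<longleftrightarrow> (\<exists>v\<in>ratliff_rush R M I n. m \<ominus>\<^bsub>M\<^esub> v \<in> elt_smult x M)"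
      using coset_eq_iff[OF P m] by (auto simp: image_iff ratliff_rush_iff)
    also have "\<dots> \<longleftrightarrow> ?R"
      by (intro translate_meets_elt_smult_iff[OF x _ m]) (auto simp: ratliff_rush_iff)
    finally show ?thesis .
  qed
  have "(\<lambda>m. elt_smult x M +>\<^bsub>M\<^esub> m) ` ratliff_rush R M I n = ratliff_rush R ?Q I n \<longleftrightarrow>
      (\<forall>m\<in>carrier M. rr_mod I x n m \<longrightarrow> (\<exists>w\<in>carrier M. m \<ominus>\<^bsub>M\<^esub> x \<odot>\<^bsub>M\<^esub> w \<in> ratliff_rush R M I n))"
    (is "?im = ?rr \<longleftrightarrow> ?lift") for n
  proof -
    have im_le: "?im \<subseteq> ?rr"
      using ratliff_rush_imp_rr_mod[OF I x] coset_in_ratliff_rush_iff[OF I x]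
      by (auto simp: ratliff_rush_iff)
    have "?im = ?rr \<longleftrightarrow> (\<forall>m\<in>carrier M. rr_mod I x n m \<longrightarrow> elt_smult x M +>\<^bsub>M\<^esub> m \<in> ?im)"
    proof
      assume eq: "?im = ?rr"
      show "\<forall>m\<in>carrier M. rr_mod I x n m \<longrightarrow> elt_smult x M +>\<^bsub>M\<^esub> m \<in> ?im"
        unfolding eq by (simp add: coset_in_ratliff_rush_iff[OF I x])
    next
      assume lift: "\<forall>m\<in>carrier M. rr_mod I x n m \<longrightarrow> elt_smult x M +>\<^bsub>M\<^esub> m \<in> ?im"
      have "X \<in> ?im" if X: "X \<in> ?rr" for X
      proof -
        have "X \<in> carrier ?Q" using X unfolding Q.ratliff_rush_iff by (rule conjunct1)
        then obtain m where m: "m \<in> carrier M" "X = elt_smult x M +>\<^bsub>M\<^esub> m"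
          unfolding carrier_quotient_module by (rule bexE)
        then have "rr_mod I x n m" using X coset_in_ratliff_rush_iff[OF I x m(1)] by simp
        then show ?thesis unfolding m(2) by (rule lift[rule_format, OF m(1)])
      qed
      then show "?im = ?rr" by (intro subset_antisym[OF im_le] subsetI)
    qed
    then show ?thesis by (simp add: coset cong: ball_cong)
  qed
  then show ?thesis by (simp add: rr_behaves_well_mod_def)
qed


section \<open>Transfer between superficial elements\<close>


text \<open>
  If \<open>w\<close> runs through the approximate quotients of \<open>a m\<close> by \<open>y\<close>, written \<open>g(a)\<close> in the
  introduction, this says that \<open>x\<^sup>i g\<close> agrees with multiplication by one element \<open>u\<close> on high
  powers of \<open>I\<close>. Division by \<open>y\<close> lowers the degree by one; hence degree \<open>Suc n\<close> in the
  hypothesis and \<open>n\<close> in the conclusion, which avoids truncated subtraction.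
\<close>

definition quotient_represented :: "'a set \<Rightarrow> 'a \<Rightarrow> 'a \<Rightarrow> nat \<Rightarrow> 'c \<Rightarrow> nat \<Rightarrow> bool"
  where "quotient_represented I x y n m i \<longleftrightarrow>
    (\<exists>u\<in>carrier M. \<exists>K. \<forall>j\<ge>K. \<forall>a\<in>ideal_pow R I j. \<forall>w\<in>carrier M.
       a \<odot>\<^bsub>M\<^esub> m \<ominus>\<^bsub>M\<^esub> y \<odot>\<^bsub>M\<^esub> w \<in> adic I (Suc n + j) \<longrightarrow>
       (x [^]\<^bsub>R\<^esub> i) \<odot>\<^bsub>M\<^esub> w \<ominus>\<^bsub>M\<^esub> a \<odot>\<^bsub>M\<^esub> u \<in> adic I (n + i + j))"

text \<open>
  Take for \<open>u\<close> an approximate quotient of \<open>x\<^sup>k m\<close> by \<open>y\<close>. For \<open>a \<in> I\<^sup>j\<close> both \<open>x\<^sup>k w\<close> and \<open>a u\<close> are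
  approximate quotients of \<open>a x\<^sup>k m\<close>, and these are unique in high degree since \<open>y\<close> is superficial.
\<close>

lemma quotient_represented_pow:
  assumes I: "ideal I R" and x: "x \<in> I" and y: "superficial R M I y"
    and m: "m \<in> carrier M" and rr: "rr_mod I y (Suc n) m"
  shows "\<exists>i. quotient_represented I x y n m i"
proof -
  have xR: "x \<in> carrier R" and yR: "y \<in> carrier R"
    using x y ideal.Icarr[OF I] by (auto simp: superficial_def)
  obtain k where k: "\<And>j a. k \<le> j \<Longrightarrow> a \<in> ideal_pow R I j \<Longrightarrow>
      \<exists>w\<in>carrier M. a \<odot>\<^bsub>M\<^esub> m \<ominus>\<^bsub>M\<^esub> y \<odot>\<^bsub>M\<^esub> w \<in> adic I (Suc n + j)"
    using rr_mod_eventually[OF I yR m rr] by blast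
  obtain n0 where n0: "\<And>n u. n0 \<le> n \<Longrightarrow> u \<in> carrier M \<Longrightarrow>
      y \<odot>\<^bsub>M\<^esub> u \<in> adic I (Suc n) \<Longrightarrow> u \<in> adic I n"
    using superficial_cancel[OF y] by blast
  let ?p = "x [^]\<^bsub>R\<^esub> k"
  have p: "?p \<in> ideal_pow R I k" "?p \<in> carrier R"
    using pow_in_ideal_pow[OF I x] xR by auto
  obtain u where u: "u \<in> carrier M" and pu: "?p \<odot>\<^bsub>M\<^esub> m \<ominus>\<^bsub>M\<^esub> y \<odot>\<^bsub>M\<^esub> u \<in> adic I (Suc n + k)"
    using k[OF order_refl p(1)] by blast
  have "?p \<odot>\<^bsub>M\<^esub> w \<ominus>\<^bsub>M\<^esub> a \<odot>\<^bsub>M\<^esub> u \<in> adic I (n + k + j)"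
    if "n0 \<le> j" and a: "a \<in> ideal_pow R I j" and w: "w \<in> carrier M"
      and aw: "a \<odot>\<^bsub>M\<^esub> m \<ominus>\<^bsub>M\<^esub> y \<odot>\<^bsub>M\<^esub> w \<in> adic I (Suc n + j)" for j a w
  proof (rule n0)
    have aR: "a \<in> carrier R" using ideal_pow_carrier[OF I a] .
    have "a \<odot>\<^bsub>M\<^esub> (?p \<odot>\<^bsub>M\<^esub> m \<ominus>\<^bsub>M\<^esub> y \<odot>\<^bsub>M\<^esub> u) \<in> adic I (Suc (n + k + j))"
      using smult_adic[OF I a pu] by (simp add: ac_simps)
    moreover have "?p \<odot>\<^bsub>M\<^esub> (a \<odot>\<^bsub>M\<^esub> m \<ominus>\<^bsub>M\<^esub> y \<odot>\<^bsub>M\<^esub> w) \<in> adic I (Suc (n + k + j))"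
      using smult_adic[OF I p(1) aw] by (simp add: ac_simps)
    ultimately have "a \<odot>\<^bsub>M\<^esub> (?p \<odot>\<^bsub>M\<^esub> m \<ominus>\<^bsub>M\<^esub> y \<odot>\<^bsub>M\<^esub> u) \<ominus>\<^bsub>M\<^esub> ?p \<odot>\<^bsub>M\<^esub> (a \<odot>\<^bsub>M\<^esub> m \<ominus>\<^bsub>M\<^esub> y \<odot>\<^bsub>M\<^esub> w)
        \<in> adic I (Suc (n + k + j))"
      by (rule submodule_minus_closed[OF adic_submodule[OF I]])
    also have "a \<odot>\<^bsub>M\<^esub> (?p \<odot>\<^bsub>M\<^esub> m \<ominus>\<^bsub>M\<^esub> y \<odot>\<^bsub>M\<^esub> u) \<ominus>\<^bsub>M\<^esub> ?p \<odot>\<^bsub>M\<^esub> (a \<odot>\<^bsub>M\<^esub> m \<ominus>\<^bsub>M\<^esub> y \<odot>\<^bsub>M\<^esub> w)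
        = y \<odot>\<^bsub>M\<^esub> (?p \<odot>\<^bsub>M\<^esub> w \<ominus>\<^bsub>M\<^esub> a \<odot>\<^bsub>M\<^esub> u)"
      using aR p yR m u w
      by (simp add: smult_minus_distrib smult_commute[of a ?p] smult_commute[of y]
          minus_minus_cancel_left)
    finally show "y \<odot>\<^bsub>M\<^esub> (?p \<odot>\<^bsub>M\<^esub> w \<ominus>\<^bsub>M\<^esub> a \<odot>\<^bsub>M\<^esub> u) \<in> adic I (Suc (n + k + j))" .
    show "?p \<odot>\<^bsub>M\<^esub> w \<ominus>\<^bsub>M\<^esub> a \<odot>\<^bsub>M\<^esub> u \<in> carrier M" using aR p u w by simp
  qed (use that in simp)
  then show ?thesis unfolding quotient_represented_def using u by blast
qed

text \<open>
  If \<open>x\<^sup>i\<^sup>+\<^sup>1 g\<close> is multiplication by \<open>u\<close>, then all products \<open>a u\<close> lie in \<open>xM\<close> up to the filtration,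
  so \<open>u\<close> is a Ratliff--Rush element mod \<open>x\<close> of degree \<open>n + i + 1\<close>. This degree is positive,
  which is where good behaviour mod \<open>x\<close> is available, and \<open>u\<close> may be replaced by some \<open>x v\<close>.
  As \<open>x\<close> is superficial, it cancels from \<open>x (x\<^sup>i g(a)) \<equiv> a (x v)\<close>.
\<close>

lemma quotient_represented_descend:
  assumes I: "ideal I R" and x: "superficial R M I x" and y: "y \<in> I"
    and well: "rr_behaves_well_mod R M I x"
    and m: "m \<in> carrier M" and rr: "rr_mod I y (Suc n) m"
    and rep: "quotient_represented I x y n m (Suc i)"
  shows "quotient_represented I x y n m i"
proof -
  have xR: "x \<in> carrier R" and yR: "y \<in> carrier R"
    using x y ideal.Icarr[OF I] by (auto simp: superficial_def)
  obtain k where k: "\<And>j a. k \<le> j \<Longrightarrow> a \<in> ideal_pow R I j \<Longrightarrow>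
      \<exists>w\<in>carrier M. a \<odot>\<^bsub>M\<^esub> m \<ominus>\<^bsub>M\<^esub> y \<odot>\<^bsub>M\<^esub> w \<in> adic I (Suc n + j)"
    using rr_mod_eventually[OF I yR m rr] by blast
  obtain n0 where n0: "\<And>n u. n0 \<le> n \<Longrightarrow> u \<in> carrier M \<Longrightarrow>
      x \<odot>\<^bsub>M\<^esub> u \<in> adic I (Suc n) \<Longrightarrow> u \<in> adic I n"
    using superficial_cancel[OF x] by blast
  let ?p = "x [^]\<^bsub>R\<^esub> i"
  have pR: "?p \<in> carrier R" using xR by simp
  have pSuc: "(x [^]\<^bsub>R\<^esub> Suc i) \<odot>\<^bsub>M\<^esub> w = x \<odot>\<^bsub>M\<^esub> (?p \<odot>\<^bsub>M\<^esub> w)" if "w \<in> carrier M" for w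
    using that xR by (simp add: smult_assoc1 smult_commute[of x])
  obtain u K where u: "u \<in> carrier M"
    and K': "\<forall>j\<ge>K. \<forall>a\<in>ideal_pow R I j. \<forall>w\<in>carrier M.
      a \<odot>\<^bsub>M\<^esub> m \<ominus>\<^bsub>M\<^esub> y \<odot>\<^bsub>M\<^esub> w \<in> adic I (Suc n + j) \<longrightarrow>
      (x [^]\<^bsub>R\<^esub> Suc i) \<odot>\<^bsub>M\<^esub> w \<ominus>\<^bsub>M\<^esub> a \<odot>\<^bsub>M\<^esub> u \<in> adic I (n + Suc i + j)"
    using rep unfolding quotient_represented_def by blast
  have K: "x \<odot>\<^bsub>M\<^esub> (?p \<odot>\<^bsub>M\<^esub> w) \<ominus>\<^bsub>M\<^esub> a \<odot>\<^bsub>M\<^esub> u \<in> adic I (Suc (n + i + j))"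
    if "K \<le> j" "a \<in> ideal_pow R I j" "w \<in> carrier M"
      "a \<odot>\<^bsub>M\<^esub> m \<ominus>\<^bsub>M\<^esub> y \<odot>\<^bsub>M\<^esub> w \<in> adic I (Suc n + j)" for j a w
    using K'[rule_format, OF that] unfolding pSuc[OF that(3)] by simp
  \<comment> \<open>The exponent has to be at least \<open>k\<close>, so that some \<open>w\<close> exists for each \<open>a\<close>, at least \<open>K\<close>, so that
    the hypothesis applies to this \<open>w\<close>, and positive.\<close>
  have "rr_mod I x (Suc (n + i)) u"
    unfolding rr_mod_def
  proof (intro exI conjI ballI)
    let ?j = "Suc (k + K)"
    fix a assume a: "a \<in> ideal_pow R I ?j"
    have aR: "a \<in> carrier R" using ideal_pow_carrier[OF I a] .
    obtain w where w: "w \<in> carrier M" "a \<odot>\<^bsub>M\<^esub> m \<ominus>\<^bsub>M\<^esub> y \<odot>\<^bsub>M\<^esub> w \<in> adic I (Suc n + ?j)"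
      using k[OF _ a] by auto
    have "\<ominus>\<^bsub>M\<^esub> (x \<odot>\<^bsub>M\<^esub> (?p \<odot>\<^bsub>M\<^esub> w) \<ominus>\<^bsub>M\<^esub> a \<odot>\<^bsub>M\<^esub> u) \<in> adic I (Suc (n + i + ?j))"
      using K[OF _ a w] by (intro submoduleE(3)[OF adic_submodule[OF I]]) simp
    then show "\<exists>w\<in>carrier M. a \<odot>\<^bsub>M\<^esub> u \<ominus>\<^bsub>M\<^esub> x \<odot>\<^bsub>M\<^esub> w \<in> adic I (Suc (n + i) + ?j)"
      using w u aR xR pR
      by (intro bexI[of _ "?p \<odot>\<^bsub>M\<^esub> w"]) (auto simp: M.minus_eq M.minus_add M.a_comm)
  qed simp
  then obtain v where v: "v \<in> carrier M" and uv: "u \<ominus>\<^bsub>M\<^esub> x \<odot>\<^bsub>M\<^esub> v \<in> ratliff_rush R M I (Suc (n + i))"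
    using well u by (auto simp: rr_behaves_well_mod_iff[OF I xR])
  obtain L where L: "\<And>j a. L \<le> j \<Longrightarrow> a \<in> ideal_pow R I j \<Longrightarrow>
      a \<odot>\<^bsub>M\<^esub> (u \<ominus>\<^bsub>M\<^esub> x \<odot>\<^bsub>M\<^esub> v) \<in> adic I (Suc (n + i) + j)"
    using ratliff_rush_eventually[OF I uv] by blast
  have "?p \<odot>\<^bsub>M\<^esub> w \<ominus>\<^bsub>M\<^esub> a \<odot>\<^bsub>M\<^esub> v \<in> adic I (n + i + j)"
    if j: "max n0 (max K L) \<le> j" and a: "a \<in> ideal_pow R I j" and w: "w \<in> carrier M"
      and aw: "a \<odot>\<^bsub>M\<^esub> m \<ominus>\<^bsub>M\<^esub> y \<odot>\<^bsub>M\<^esub> w \<in> adic I (Suc n + j)" for j a w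
  proof (rule n0)
    have aR: "a \<in> carrier R" using ideal_pow_carrier[OF I a] .
    have "(x \<odot>\<^bsub>M\<^esub> (?p \<odot>\<^bsub>M\<^esub> w) \<ominus>\<^bsub>M\<^esub> a \<odot>\<^bsub>M\<^esub> u) \<oplus>\<^bsub>M\<^esub> a \<odot>\<^bsub>M\<^esub> (u \<ominus>\<^bsub>M\<^esub> x \<odot>\<^bsub>M\<^esub> v) \<in> adic I (Suc (n + i + j))"
      using K[OF _ a w aw] L[OF _ a] j
      by (intro submoduleE(5)[OF adic_submodule[OF I]]) auto
    also have "(x \<odot>\<^bsub>M\<^esub> (?p \<odot>\<^bsub>M\<^esub> w) \<ominus>\<^bsub>M\<^esub> a \<odot>\<^bsub>M\<^esub> u) \<oplus>\<^bsub>M\<^esub> a \<odot>\<^bsub>M\<^esub> (u \<ominus>\<^bsub>M\<^esub> x \<odot>\<^bsub>M\<^esub> v)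
        = x \<odot>\<^bsub>M\<^esub> (?p \<odot>\<^bsub>M\<^esub> w \<ominus>\<^bsub>M\<^esub> a \<odot>\<^bsub>M\<^esub> v)"
      using aR pR xR u v w
      by (simp add: smult_minus_distrib smult_commute[of a x] minus_add_minus_cancel)
    finally show "x \<odot>\<^bsub>M\<^esub> (?p \<odot>\<^bsub>M\<^esub> w \<ominus>\<^bsub>M\<^esub> a \<odot>\<^bsub>M\<^esub> v) \<in> adic I (Suc (n + i + j))" .
    show "?p \<odot>\<^bsub>M\<^esub> w \<ominus>\<^bsub>M\<^esub> a \<odot>\<^bsub>M\<^esub> v \<in> carrier M" using aR pR v w by simp
  qed (use j in simp)
  then show ?thesis unfolding quotient_represented_def using v by blast
qed

text \<open>
  With \<open>w \<equiv> a u\<close> for all \<open>a\<close> in high powers of \<open>I\<close>, multiplication by \<open>y \<in> I\<close> restores the lost degree,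
  so \<open>a m\<close> and \<open>a y u\<close> agree and \<open>m - y u\<close> is a Ratliff--Rush element of \<open>M\<close>.
\<close>

lemma quotient_represented_zero_lift:
  assumes I: "ideal I R" and y: "y \<in> I"
    and m: "m \<in> carrier M" and rr: "rr_mod I y (Suc n) m"
    and rep: "quotient_represented I x y n m 0"
  shows "\<exists>u\<in>carrier M. m \<ominus>\<^bsub>M\<^esub> y \<odot>\<^bsub>M\<^esub> u \<in> ratliff_rush R M I (Suc n)"
proof -
  have yR: "y \<in> carrier R" using y ideal.Icarr[OF I] by blast
  obtain k where k: "\<And>j a. k \<le> j \<Longrightarrow> a \<in> ideal_pow R I j \<Longrightarrow>
      \<exists>w\<in>carrier M. a \<odot>\<^bsub>M\<^esub> m \<ominus>\<^bsub>M\<^esub> y \<odot>\<^bsub>M\<^esub> w \<in> adic I (Suc n + j)"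
    using rr_mod_eventually[OF I yR m rr] by blast
  obtain u K where u: "u \<in> carrier M"
    and K': "\<forall>j\<ge>K. \<forall>a\<in>ideal_pow R I j. \<forall>w\<in>carrier M.
      a \<odot>\<^bsub>M\<^esub> m \<ominus>\<^bsub>M\<^esub> y \<odot>\<^bsub>M\<^esub> w \<in> adic I (Suc n + j) \<longrightarrow>
      (x [^]\<^bsub>R\<^esub> (0::nat)) \<odot>\<^bsub>M\<^esub> w \<ominus>\<^bsub>M\<^esub> a \<odot>\<^bsub>M\<^esub> u \<in> adic I (n + 0 + j)"
    using rep unfolding quotient_represented_def by blast
  have K: "w \<ominus>\<^bsub>M\<^esub> a \<odot>\<^bsub>M\<^esub> u \<in> adic I (n + j)"
    if "K \<le> j" "a \<in> ideal_pow R I j" "w \<in> carrier M"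
      "a \<odot>\<^bsub>M\<^esub> m \<ominus>\<^bsub>M\<^esub> y \<odot>\<^bsub>M\<^esub> w \<in> adic I (Suc n + j)" for j a w
    using K'[rule_format, OF that] that(3) by simp
  have "a \<odot>\<^bsub>M\<^esub> (m \<ominus>\<^bsub>M\<^esub> y \<odot>\<^bsub>M\<^esub> u) \<in> adic I (Suc n + j)"
    if j: "k + K \<le> j" and a: "a \<in> ideal_pow R I j" for j a
  proof -
    have aR: "a \<in> carrier R" using ideal_pow_carrier[OF I a] .
    obtain w where w: "w \<in> carrier M" and aw: "a \<odot>\<^bsub>M\<^esub> m \<ominus>\<^bsub>M\<^esub> y \<odot>\<^bsub>M\<^esub> w \<in> adic I (Suc n + j)"
      using k[OF _ a] j by auto
    have "y \<odot>\<^bsub>M\<^esub> (w \<ominus>\<^bsub>M\<^esub> a \<odot>\<^bsub>M\<^esub> u) \<in> adic I (Suc n + j)"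
      using smult_ideal_adic[OF I y K[OF _ a w aw]] j by simp
    with aw have "(a \<odot>\<^bsub>M\<^esub> m \<ominus>\<^bsub>M\<^esub> y \<odot>\<^bsub>M\<^esub> w) \<oplus>\<^bsub>M\<^esub> y \<odot>\<^bsub>M\<^esub> (w \<ominus>\<^bsub>M\<^esub> a \<odot>\<^bsub>M\<^esub> u) \<in> adic I (Suc n + j)"
      by (rule submoduleE(5)[OF adic_submodule[OF I]])
    also have "(a \<odot>\<^bsub>M\<^esub> m \<ominus>\<^bsub>M\<^esub> y \<odot>\<^bsub>M\<^esub> w) \<oplus>\<^bsub>M\<^esub> y \<odot>\<^bsub>M\<^esub> (w \<ominus>\<^bsub>M\<^esub> a \<odot>\<^bsub>M\<^esub> u) = a \<odot>\<^bsub>M\<^esub> (m \<ominus>\<^bsub>M\<^esub> y \<odot>\<^bsub>M\<^esub> u)"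
      using aR yR m u w
      by (simp add: smult_minus_distrib smult_commute[of y a] minus_add_minus_cancel)
    finally show ?thesis .
  qed
  from this[of "Suc (k + K)"] have "m \<ominus>\<^bsub>M\<^esub> y \<odot>\<^bsub>M\<^esub> u \<in> ratliff_rush R M I (Suc n)"
    unfolding ratliff_rush_iff using m u yR
    by (intro conjI exI[of _ "Suc (k + K)"] ballI) simp_all
  then show ?thesis using u by blast
qed

lemma rr_behaves_well_mod_transfer:
  assumes I: "ideal I R" and x: "superficial R M I x" and y: "superficial R M I y"
    and well: "rr_behaves_well_mod R M I x"
  shows "rr_behaves_well_mod R M I y"
proof -
  have xI: "x \<in> I" and yI: "y \<in> I" using x y by (auto simp: superficial_def)
  show ?thesis
    unfolding rr_behaves_well_mod_iff[OF I ideal.Icarr[OF I yI]]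
  proof (intro allI impI ballI)
    fix n m assume "1 \<le> n" and m: "m \<in> carrier M" and "rr_mod I y n m"
    then obtain n' where n: "n = Suc n'" and rr: "rr_mod I y (Suc n') m"
      by (cases n) auto
    obtain i where "quotient_represented I x y n' m i"
      using quotient_represented_pow[OF I xI y m rr] by blast
    then have "quotient_represented I x y n' m 0"
      by (induction i) (auto intro: quotient_represented_descend[OF I x yI well m rr])
    then show "\<exists>u\<in>carrier M. m \<ominus>\<^bsub>M\<^esub> y \<odot>\<^bsub>M\<^esub> u \<in> ratliff_rush R M I n"
      unfolding n by (rule quotient_represented_zero_lift[OF I yI m rr])
  qed
qed

end

theorem corollary3p4:
  fixes A :: "('a, 'r) ring_scheme" and \<mm> :: "'a set"
    and M :: "('a, 'b, 'm) module_scheme"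
    and r :: nat and I :: "'a set" and x y :: 'a
  assumes "noetherian_local_ring \<mm> A"
    and "infinite (carrier (A Quot \<mm>))"
    and "module A M"
    and "finitely_generated_module A M"
    and "cohen_macaulay_module A \<mm> M"
    and "module_dim A M = enat r"
    and "r \<ge> 2"
    and "ideal_of_definition A \<mm> M I"
    and "x \<in> I" and "y \<in> I" and "x \<noteq> y"
    and "superficial A M I x"
    and "superficial A M I y"
  shows "rr_behaves_well_mod A M I x \<longleftrightarrow> rr_behaves_well_mod A M I y"
proof -
  interpret module A M by fact
  have "ideal I A" using assms(8) by (simp add: ideal_of_definition_def)
  then show ?thesis using rr_behaves_well_mod_transfer assms(12,13) by blast
qed

end
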